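(* Let $m,n,k$ be positive integers, $X\in\mathbb{R}^{m\times n}$, and let $J(W,S)=\tfrac12\|X-WS\|_F^2$ on $\mathcal{X}=\mathbb{R}^{m\times k}\times\mathbb{R}^{k\times n}$. Let $(W,S)\in\mathcal{X}$. Then: (a) If $(W,S)$ is a critical point (respectively a global minimum, respectively a strict saddle) of $J$, then so are all points of $\Theta(W,S)$. (b) $\nabla^2 J$ has the same inertia at all points of $\Theta(W,S)$. (c) $\nabla^2 J$ has the same eigenvalues at all points of $\mathcal{O}(W,S)$. (d) For each $A\in\mathrm{GL}_k$, $$\lambda_{\min}\big(\nabla^2 J(L_A(W,S))\big)\le \frac{\lambda_{\min}(\nabla^2 J(W,S))}{\max\{\lambda_{\max}(AA^T),\ \lambda_{\min}^{-1}(AA^T)\}} .$$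
   Context: $\mathcal{X}=\mathbb{R}^{m\times k}\times\mathbb{R}^{k\times n}$ carries the inner product $\langle (G,H),(G',H')\rangle=\mathrm{trace}(G^TG')+\mathrm{trace}(H^TH')$. The gradient and Hessian of $J$ are taken with respect to this inner product; the Hessian map at $(W,S)$ is the self-adjoint linear map $\nabla^2J(W,S):\mathcal{X}\to\mathcal{X}$, the derivative of $(W,S)\mapsto\nabla J(W,S)$. With $E=WS-X$: $\nabla J(W,S)=(ES^T,\,W^TE)$ and $\nabla^2J(W,S)[(G,H)]=(GSS^T+WHS^T+EH^T,\ W^TWH+W^TGS+G^TE)$. A critical point is a point where $\nabla J=0$; a strict saddle is a critical point at which $\lambda_{\min}(\nabla^2J)<0$. Here $\lambda_{\min}$ and $\lambda_{\max}$ denote the smallest and largest eigenvalue, and $\lambda_{\min}^{-1}(AA^T)=1/\lambda_{\min}(AA^T)$. The inertia of a self-adjoint map is the triple of the numbers of its positive, negative and zero eigenvalues. $\mathrm{GL}_k$ is the group of invertible real $k\times k$ matrices and $\mathrm{O}_k$ the subgroup of orthogonal matrices. For $A\in\mathrm{GL}_k$, $L_A(G,H)=(GA,A^{-1}H)$. Orbits: $\Theta(W,S)=\{L_A(W,S):A\in\mathrm{GL}_k\}$ and $\mathcal{O}(W,S)=\{L_Q(W,S):Q\in\mathrm{O}_k\}$.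
   Formalization: Part (d) is stated only when (W,S) is a critical point or the smallest eigenvalue of the Hessian at (W,S) is ≤ 0; as printed it fails for positive definite Hessians, e.g. m=n=k=1, X=4, (W,S)=(1,2), A=√2. *)

theory Defs
  imports "HOL-Analysis.Analysis"
begin

text \<open>A matrix in \<open>R^(m x k)\<close> has type \<open>real ^ 'k ^ 'm\<close>. The library inner product on matrices is the
  trace inner product and the one on pairs is the sum over the components, so on
  \<open>(real ^ 'k ^ 'm) \<times> (real ^ 'n ^ 'k)\<close> they give the inner product in use here (see
  \<open>inner_pair_eq_trace\<close>); likewise \<open>norm\<close> on matrices is the Frobenius norm.\<close>

lemma inner_matrix_eq_trace:
  fixes G G' :: "real ^ 'b ^ 'a"
  shows "inner G G' = trace (transpose G ** G')"
  unfolding trace_def inner_vec_def matrix_matrix_mult_def transpose_def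
  by (simp, rule sum.swap)

lemma inner_pair_eq_trace:
  fixes G G' :: "real ^ 'k ^ 'm" and H H' :: "real ^ 'n ^ 'k"
  shows "inner (G, H) (G', H') = trace (transpose G ** G') + trace (transpose H ** H')"
  by (simp add: inner_matrix_eq_trace)

subsection \<open>Gradient, Hessian and critical points\<close>

definition grad :: "('a::real_inner \<Rightarrow> real) \<Rightarrow> 'a \<Rightarrow> 'a"
  where "grad f p = (THE D. GDERIV f p :> D)"

definition hess :: "('a::real_inner \<Rightarrow> real) \<Rightarrow> 'a \<Rightarrow> 'a \<Rightarrow> 'a"
  where "hess f p = frechet_derivative (grad f) (at p)"

definition critical_point :: "('a::real_inner \<Rightarrow> real) \<Rightarrow> 'a \<Rightarrow> bool"
  where "critical_point f p \<longleftrightarrow> grad f p = 0"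

definition global_minimum :: "('a \<Rightarrow> real) \<Rightarrow> 'a \<Rightarrow> bool"
  where "global_minimum f p \<longleftrightarrow> (\<forall>q. f p \<le> f q)"

subsection \<open>Eigenvalues and inertia\<close>

definition eigenspace :: "('a::real_vector \<Rightarrow> 'a) \<Rightarrow> real \<Rightarrow> 'a set"
  where "eigenspace f c = {v. f v = c *\<^sub>R v}"

definition eigenvalues :: "('a::real_vector \<Rightarrow> 'a) \<Rightarrow> real set"
  where "eigenvalues f = {c. \<exists>v. v \<noteq> 0 \<and> f v = c *\<^sub>R v}"

text \<open>The next four are meant for self-adjoint maps on a Euclidean space: the set of eigenvalues is then
  finite and nonempty, and the multiplicity of an eigenvalue is the dimension of its eigenspace.\<close>

definition lambda_min :: "('a::euclidean_space \<Rightarrow> 'a) \<Rightarrow> real"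
  where "lambda_min f = Min (eigenvalues f)"

definition lambda_max :: "('a::euclidean_space \<Rightarrow> 'a) \<Rightarrow> real"
  where "lambda_max f = Max (eigenvalues f)"

definition eigenvalue_multiplicity :: "('a::euclidean_space \<Rightarrow> 'a) \<Rightarrow> real \<Rightarrow> nat"
  where "eigenvalue_multiplicity f c = dim (eigenspace f c)"

definition inertia :: "('a::euclidean_space \<Rightarrow> 'a) \<Rightarrow> nat \<times> nat \<times> nat"
  where "inertia f =
    (\<Sum>c \<in> {c \<in> eigenvalues f. 0 < c}. eigenvalue_multiplicity f c,
     \<Sum>c \<in> {c \<in> eigenvalues f. c < 0}. eigenvalue_multiplicity f c,
     \<Sum>c \<in> {c \<in> eigenvalues f. c = 0}. eigenvalue_multiplicity f c)"

definition strict_saddle :: "('a::euclidean_space \<Rightarrow> real) \<Rightarrow> 'a \<Rightarrow> bool"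
  where "strict_saddle f p \<longleftrightarrow> critical_point f p \<and> lambda_min (hess f p) < 0"

subsection \<open>The objective and the group action\<close>

definition J :: "real ^ 'n ^ 'm \<Rightarrow> (real ^ 'k ^ 'm) \<times> (real ^ 'n ^ 'k) \<Rightarrow> real"
  where "J X p = (1/2) * (norm (X - fst p ** snd p))\<^sup>2"

definition L :: "real ^ 'k ^ 'k \<Rightarrow> (real ^ 'k ^ 'm) \<times> (real ^ 'n ^ 'k)
    \<Rightarrow> (real ^ 'k ^ 'm) \<times> (real ^ 'n ^ 'k)"
  where "L A p = (fst p ** A, matrix_inv A ** snd p)"

definition GL_orbit :: "(real ^ 'k ^ 'm) \<times> (real ^ 'n ^ 'k) \<Rightarrow> ((real ^ 'k ^ 'm) \<times> (real ^ 'n ^ 'k)) set"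
  where "GL_orbit p = {L A p | A. invertible A}"

definition O_orbit :: "(real ^ 'k ^ 'm) \<times> (real ^ 'n ^ 'k) \<Rightarrow> ((real ^ 'k ^ 'm) \<times> (real ^ 'n ^ 'k)) set"
  where "O_orbit p = {L Q p | Q. orthogonal_matrix Q}"

subsection \<open>Explicit gradient and Hessian\<close>

lemma matrix_mult_add_left:
  fixes A B :: "real ^ 'b ^ 'a" and C :: "real ^ 'c ^ 'b"
  shows "(A + B) ** C = A ** C + B ** C"
  by (simp add: vec_eq_iff matrix_matrix_mult_def sum.distrib distrib_right)

lemma bounded_bilinear_matrix_mult:
  "bounded_bilinear ((**) :: real ^ 'b ^ 'a \<Rightarrow> real ^ 'c ^ 'b \<Rightarrow> real ^ 'c ^ 'a)"
  unfolding bilinear_conv_bounded_bilinear[symmetric] bilinear_def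
  by (auto intro!: linearI simp: vec_eq_iff matrix_matrix_mult_def sum.distrib sum_distrib_left
      algebra_simps)

lemma bounded_linear_transpose:
  "bounded_linear (transpose :: real ^ 'b ^ 'a \<Rightarrow> real ^ 'a ^ 'b)"
  by (intro linear_conv_bounded_linear[THEN iffD1] linearI)
    (simp_all add: vec_eq_iff transpose_def)

lemma inner_matrix_mult_left:
  fixes W :: "real ^ 'b ^ 'a" and H :: "real ^ 'c ^ 'b" and E :: "real ^ 'c ^ 'a"
  shows "inner (W ** H) E = inner H (transpose W ** E)"
  by (simp add: inner_matrix_eq_trace matrix_transpose_mul matrix_mul_assoc)

lemma inner_matrix_mult_right:
  fixes W :: "real ^ 'b ^ 'a" and H :: "real ^ 'c ^ 'b" and E :: "real ^ 'c ^ 'a"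
  shows "inner (W ** H) E = inner W (E ** transpose H)"
  unfolding inner_matrix_eq_trace matrix_transpose_mul
  by (metis matrix_mul_assoc trace_mul_sym)

lemmas has_derivative_matrix_mult [derivative_intros] =
  bounded_bilinear.FDERIV[OF bounded_bilinear_matrix_mult]
lemmas has_derivative_transpose [derivative_intros] =
  bounded_linear.has_derivative[OF bounded_linear_transpose]

lemma GDERIV_imp_grad:
  assumes "GDERIV f p :> D"
  shows "grad f p = D"
  unfolding grad_def
proof (rule the_equality)
  fix D' assume "GDERIV f p :> D'"
  hence "(\<lambda>h. inner h D') = (\<lambda>h. inner h D)"
    using assms unfolding gderiv_def by (rule has_derivative_unique)
  thus "D' = D" by (metis inner_commute vector_eq_ldot)
qed (fact assms)

lemma GDERIV_J:
  fixes X :: "real ^ 'n ^ 'm" and W :: "real ^ 'k ^ 'm" and S :: "real ^ 'n ^ 'k"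
  defines "E \<equiv> W ** S - X"
  shows "GDERIV (J X) (W, S) :> (E ** transpose S, transpose W ** E)"
proof -
  have J: "J X = (\<lambda>p. (1/2) * inner (fst p ** snd p - X) (fst p ** snd p - X))"
    by (auto simp: J_def fun_eq_iff norm_minus_commute simp flip: power2_norm_eq_inner)
  show ?thesis
    unfolding gderiv_def J
    by (rule has_derivative_eq_rhs, (rule derivative_intros)+)
      (auto simp: fun_eq_iff E_def inner_add_left inner_add_right inner_commute
        inner_matrix_mult_left[of W, symmetric] inner_matrix_mult_right[of _ S, symmetric])
qed

lemma grad_J:
  fixes X :: "real ^ 'n ^ 'm" and W :: "real ^ 'k ^ 'm" and S :: "real ^ 'n ^ 'k"
  defines "E \<equiv> W ** S - X"
  shows "grad (J X) (W, S) = (E ** transpose S, transpose W ** E)"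
  unfolding E_def by (rule GDERIV_imp_grad[OF GDERIV_J])

lemma has_derivative_grad_J:
  fixes X :: "real ^ 'n ^ 'm" and W :: "real ^ 'k ^ 'm" and S :: "real ^ 'n ^ 'k"
  defines "E \<equiv> W ** S - X"
  shows "(grad (J X) has_derivative
    (\<lambda>(G, H). (G ** S ** transpose S + W ** H ** transpose S + E ** transpose H,
               transpose W ** W ** H + transpose W ** G ** S + transpose G ** E))) (at (W, S))"
proof -
  have g: "grad (J X) = (\<lambda>p. ((fst p ** snd p - X) ** transpose (snd p),
      transpose (fst p) ** (fst p ** snd p - X)))"
    by (auto simp: grad_J)
  show ?thesis
    unfolding g
    by (rule has_derivative_eq_rhs, (rule derivative_intros)+)
      (auto simp: fun_eq_iff E_def matrix_add_ldistrib matrix_mult_add_left matrix_mul_assoc)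
qed

lemma hess_J:
  fixes X :: "real ^ 'n ^ 'm" and W :: "real ^ 'k ^ 'm" and S :: "real ^ 'n ^ 'k"
  defines "E \<equiv> W ** S - X"
  shows "hess (J X) (W, S) (G, H) =
    (G ** S ** transpose S + W ** H ** transpose S + E ** transpose H,
     transpose W ** W ** H + transpose W ** G ** S + transpose G ** E)"
  unfolding hess_def E_def
  by (simp flip: frechet_derivative_at[OF has_derivative_grad_J])

subsection \<open>Positive \<open>lambda_min\<close> under the group action\<close>

text \<open>The bound for \<open>lambda_min\<close> along a \<open>GL\<close>-orbit fails where the Hessian is positive definite (this
  cannot happen at a critical point). For \<open>m = n = k = 1\<close>, \<open>X = 4\<close>, the Hessian is \<open>diag(4, 1)\<close> at \<open>(1, 2)\<close>
  and \<open>diag(2, 2)\<close> at \<open>(sqrt 2, sqrt 2)\<close>, the image under \<open>A = sqrt 2\<close>; the bound would say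
  \<open>2 \<le> 1 / max 2 (1/2)\<close>. Hence the sign condition in the theorem.\<close>

lemma vec1_eq_mat: "G = mat (G $ 1 $ 1)" for G :: "real ^ 1 ^ 1"
  by (simp add: vec_eq_iff mat_def)

lemma mat1_simps:
  fixes a b :: real
  shows "(mat a :: real ^ 1 ^ 1) ** mat b = mat (a * b)"
    and "(mat a :: real ^ 1 ^ 1) + mat b = mat (a + b)"
    and "(mat a :: real ^ 1 ^ 1) - mat b = mat (a - b)"
    and "c *\<^sub>R (mat a :: real ^ 1 ^ 1) = mat (c * a)"
    and "(mat a :: real ^ 1 ^ 1) = mat b \<longleftrightarrow> a = b"
    and "(mat a :: real ^ 1 ^ 1) = 0 \<longleftrightarrow> a = 0"
  by (simp_all add: vec_eq_iff mat_def matrix_matrix_mult_def)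

lemma eigenvalues_diag:
  fixes f :: "(real ^ 1 ^ 1) \<times> (real ^ 1 ^ 1) \<Rightarrow> (real ^ 1 ^ 1) \<times> (real ^ 1 ^ 1)"
  assumes "\<And>g h. f (mat g, mat h) = (mat (a * g), mat (b * h))"
  shows "eigenvalues f = {a, b}"
proof -
  have "c \<in> eigenvalues f \<longleftrightarrow> (\<exists>g h. (g \<noteq> 0 \<or> h \<noteq> 0) \<and> a * g = c * g \<and> b * h = c * h)" for c
  proof -
    have "c \<in> eigenvalues f \<longleftrightarrow>
        (\<exists>g h. (mat g :: real ^ 1 ^ 1, mat h :: real ^ 1 ^ 1) \<noteq> 0 \<and> f (mat g, mat h) = c *\<^sub>R (mat g, mat h))"
      unfolding eigenvalues_def mem_Collect_eq split_paired_Ex by (metis vec1_eq_mat)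
    thus ?thesis by (simp add: assms mat1_simps zero_prod_def)
  qed
  thus ?thesis by (auto simp: set_eq_iff)
qed

lemma lambda_min_bound_fails:
  defines "X \<equiv> mat 4 :: real ^ 1 ^ 1" and "p \<equiv> (mat 1 :: real ^ 1 ^ 1, mat 2 :: real ^ 1 ^ 1)"
    and "A \<equiv> mat (sqrt 2) :: real ^ 1 ^ 1"
  shows "invertible A"
    and "lambda_min (hess (J X) p) = 1"
    and "\<not> lambda_min (hess (J X) (L A p)) \<le>
           lambda_min (hess (J X) p) /
           max (lambda_max ((*v) (A ** transpose A))) (1 / lambda_min ((*v) (A ** transpose A)))"
proof -
  have inv: "A ** mat (1 / sqrt 2) = mat 1" "mat (1 / sqrt 2) ** A = mat 1"
    by (simp_all add: A_def mat1_simps)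
  thus "invertible A" unfolding invertible_def by blast
  have "matrix_inv A = mat (1 / sqrt 2)"
    unfolding matrix_inv_def
  proof (rule some_equality)
    fix B assume "A ** B = mat 1 \<and> B ** A = mat 1"
    thus "B = mat (1 / sqrt 2)" by (metis inv(1) matrix_mul_assoc matrix_mul_lid matrix_mul_rid)
  qed (use inv in blast)
  hence Lp: "L A p = (mat (sqrt 2), mat (sqrt 2))"
    by (simp add: L_def p_def A_def mat1_simps real_div_sqrt)
  have "eigenvalues (hess (J X) p) = {4, 1}"
    by (rule eigenvalues_diag) (simp add: hess_J p_def X_def mat1_simps transpose_mat)
  thus 1: "lambda_min (hess (J X) p) = 1" by (simp add: lambda_min_def)
  have sq: "sqrt 2 * (sqrt 2 * x) = 2 * x" "sqrt 2 * (x * sqrt 2) = 2 * x" for x :: real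
    by (simp_all flip: mult.assoc add: mult.commute[of x])
  have "eigenvalues (hess (J X) (L A p)) = {2, 2}"
    by (rule eigenvalues_diag)
      (simp add: hess_J Lp X_def mat1_simps transpose_mat mult.assoc sq mult.commute[of _ 2])
  hence 2: "lambda_min (hess (J X) (L A p)) = 2" by (simp add: lambda_min_def)
  have AAT: "A ** transpose A = mat 2"
    by (simp add: A_def mat1_simps transpose_mat)
  have "(A ** transpose A) *v v = 2 *\<^sub>R v" for v
    unfolding AAT by (simp add: vec_eq_iff mat_def matrix_vector_mult_def)
  hence "eigenvalues ((*v) (A ** transpose A)) = {2}"
    by (auto simp: eigenvalues_def intro!: exI[of _ 1])
  hence "lambda_max ((*v) (A ** transpose A)) = 2" "lambda_min ((*v) (A ** transpose A)) = 2"
    by (simp_all add: lambda_min_def lambda_max_def)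
  thus "\<not> lambda_min (hess (J X) (L A p)) \<le> lambda_min (hess (J X) p) /
           max (lambda_max ((*v) (A ** transpose A))) (1 / lambda_min ((*v) (A ** transpose A)))"
    by (simp add: 1 2)
qed

end

(* The bilinear form u . hess (J X) p v depends on p, u, v only through the products of the first
   component of one of them with the second component of another, and L A, applied to all three, leaves
   these products unchanged. So L A is a congruence between the Hessians along an orbit, which gives the
   inertia by Sylvester's law, and an isometric one when A is orthogonal, which gives the eigenvalues.
   The bound on lambda_min is the Rayleigh quotient at L A v for a minimal eigenvector v, with
   |L A v|^2 <= max (lambda_max (A A^T)) (1 / lambda_min (A A^T)) |v|^2. *)
theory Submission
  imports Defs
begin

section \<open>Self-adjoint maps\<close>

definition self_adjoint :: "('a::real_inner \<Rightarrow> 'a) \<Rightarrow> bool"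
  where "self_adjoint f \<longleftrightarrow> linear f \<and> (\<forall>x y. x \<bullet> f y = f x \<bullet> y)"

lemma self_adjoint_uminus: "self_adjoint f \<Longrightarrow> self_adjoint (\<lambda>x. - f x)"
  by (simp add: self_adjoint_def linear_compose_neg)

text \<open>The Rayleigh quotient attains its minimum on the compact unit sphere of
  \<open>V\<close>, and a minimizer is an eigenvector. Invariance of \<open>V\<close> keeps the
  residual \<open>f u - c *\<^sub>R u\<close> inside \<open>V\<close>. A general \<open>V\<close>
  allows the use on sums of eigenspaces and on their complements.\<close>

lemma invariant_subspace_min_eigenvector:
  fixes f :: "'a::euclidean_space \<Rightarrow> 'a"
  assumes f: "self_adjoint f" and V: "subspace V" "f ` V \<subseteq> V" and nz: "\<not> V \<subseteq> {0}"
  obtains c u where "u \<in> V" "u \<noteq> 0" "f u = c *\<^sub>R u" "\<And>x. x \<in> V \<Longrightarrow> c * (x \<bullet> x) \<le> x \<bullet> f x"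
proof -
  have lin: "linear f" and sa: "\<And>x y. x \<bullet> f y = f x \<bullet> y"
    using f by (auto simp: self_adjoint_def)
  define K where "K = V \<inter> sphere 0 1"
  have "compact K"
    unfolding K_def by (intro closed_Int_compact closed_subspace V compact_sphere)
  moreover obtain v where "v \<in> V" "v \<noteq> 0" using nz by blast
  hence "v /\<^sub>R norm v \<in> K" by (simp add: K_def V subspace_scale)
  hence "K \<noteq> {}" by blast
  moreover have "continuous_on K (\<lambda>x. x \<bullet> f x)"
    by (intro continuous_intros linear_continuous_on linear_conv_bounded_linear[THEN iffD1] lin)
  ultimately obtain u where u: "u \<in> K" and umin: "\<And>x. x \<in> K \<Longrightarrow> u \<bullet> f u \<le> x \<bullet> f x"
    using continuous_attains_inf by metis
  define c where "c = u \<bullet> f u"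
  have uV: "u \<in> V" "u \<bullet> u = 1" using u by (auto simp: K_def dot_square_norm)
  have ge: "c * (x \<bullet> x) \<le> x \<bullet> f x" if x: "x \<in> V" for x
  proof (cases "x = 0")
    case False
    hence "x /\<^sub>R norm x \<in> K" using x by (simp add: K_def V subspace_scale)
    hence "c \<le> (x /\<^sub>R norm x) \<bullet> f (x /\<^sub>R norm x)" unfolding c_def by (rule umin)
    also have "\<dots> = (x \<bullet> f x) / (x \<bullet> x)"
      by (simp add: linear_cmul[OF lin] dot_square_norm power2_eq_square field_simps)
    finally show ?thesis using False by (simp add: field_simps)
  qed (simp add: linear_0[OF lin])
  define w where "w = f u - c *\<^sub>R u"
  have wV: "w \<in> V"
    unfolding w_def using uV V by (auto intro!: subspace_diff subspace_scale)
  define a where "a = w \<bullet> w"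
  define b where "b = w \<bullet> f w - c * (w \<bullet> w)"
  have b: "0 \<le> b" using ge[OF wV] by (simp add: b_def)
  \<comment> \<open>The form \<open>x \<bullet> f x - c * (x \<bullet> x)\<close> is nonnegative on \<open>V\<close> and vanishes at \<open>u\<close>; stepping
    from \<open>u\<close> against its gradient \<open>w\<close> would make it negative unless \<open>w = 0\<close>.\<close>
  have q: "0 \<le> t\<^sup>2 * b + 2 * t * a" for t
  proof -
    have "u + t *\<^sub>R w \<in> V" using uV wV V by (simp add: subspace_add subspace_scale)
    hence "0 \<le> (u + t *\<^sub>R w) \<bullet> f (u + t *\<^sub>R w) - c * ((u + t *\<^sub>R w) \<bullet> (u + t *\<^sub>R w))"
      using ge by simp
    also have "\<dots> = t\<^sup>2 * b + 2 * t * (w \<bullet> f u - c * (w \<bullet> u))"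
      using uV(2) sa[of u w]
      by (simp add: linear_add[OF lin] linear_cmul[OF lin] inner_add_left inner_add_right
          b_def c_def[symmetric] inner_commute power2_eq_square algebra_simps)
    also have "w \<bullet> f u - c * (w \<bullet> u) = a"
      by (simp add: a_def w_def inner_diff_right)
    finally show ?thesis .
  qed
  \<comment> \<open>The step is \<open>t = - s\<close>; the denominator \<open>b + 1\<close> is
    positive even if \<open>b = 0\<close>, and the value becomes
    \<open>- (s\<^sup>2 * (b + 2))\<close>.\<close>
  define s where "s = a / (b + 1)"
  have s: "a = s * (b + 1)" using b by (simp add: s_def)
  have "0 \<le> (- s)\<^sup>2 * b + 2 * (- s) * a" by (rule q)
  also have "\<dots> = - (s\<^sup>2 * (b + 2))" by (simp add: s power2_eq_square algebra_simps)
  finally have "s\<^sup>2 * (b + 2) \<le> 0" by simp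
  hence "s = 0" using b by (auto simp: mult_le_0_iff)
  hence "a = 0" by (simp add: s)
  hence "f u = c *\<^sub>R u" by (simp add: a_def w_def)
  moreover have "u \<noteq> 0" using uV by auto
  ultimately show ?thesis using that uV ge by blast
qed

lemma eigenspaces_orthogonal:
  assumes "self_adjoint f" "x \<in> eigenspace f c" "y \<in> eigenspace f d" "c \<noteq> d"
  shows "orthogonal x y"
proof -
  have "d * (x \<bullet> y) = c * (x \<bullet> y)"
    using assms unfolding self_adjoint_def eigenspace_def
    by (metis (mono_tags) inner_scaleR_left inner_scaleR_right mem_Collect_eq)
  thus ?thesis using assms(4) by (simp add: orthogonal_def)
qed

text \<open>One eigenvector chosen per eigenvalue gives a pairwise orthogonal family of nonzero
  vectors, which is injective and finite.\<close>

lemma finite_eigenvalues: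
  fixes f :: "'a::euclidean_space \<Rightarrow> 'a"
  assumes "self_adjoint f"
  shows "finite (eigenvalues f)"
proof -
  obtain v where v: "\<And>c. c \<in> eigenvalues f \<Longrightarrow> v c \<noteq> 0 \<and> f (v c) = c *\<^sub>R v c"
    using that[of "\<lambda>c. SOME v. v \<noteq> 0 \<and> f v = c *\<^sub>R v"]
    by (metis (mono_tags, lifting) eigenvalues_def mem_Collect_eq someI_ex)
  have orth: "orthogonal (v c) (v d)" if "c \<in> eigenvalues f" "d \<in> eigenvalues f" "c \<noteq> d" for c d
    using eigenspaces_orthogonal[OF assms _ _ that(3)] v that by (auto simp: eigenspace_def)
  hence "inj_on v (eigenvalues f)"
    using v by (metis inj_onI orthogonal_self)
  moreover have "finite (v ` eigenvalues f)"
    using orth by (intro pairwise_orthogonal_imp_finite) (auto simp: pairwise_def)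
  ultimately show ?thesis by (simp add: finite_image_iff)
qed

text \<open>Evaluating the Rayleigh bound at any eigenvector shows that the minimal quotient lies
  below every eigenvalue. This ties the \<open>Min\<close> in \<open>lambda_min\<close> to the
  quadratic form.\<close>

lemma lambda_min_eigenvector:
  fixes f :: "'a::euclidean_space \<Rightarrow> 'a"
  assumes "self_adjoint f"
  obtains u where "u \<noteq> 0" "f u = lambda_min f *\<^sub>R u"
    "\<And>x. lambda_min f * (x \<bullet> x) \<le> x \<bullet> f x"
proof -
  obtain b :: 'a where "b \<in> Basis" using nonempty_Basis by blast
  hence "\<not> (UNIV :: 'a set) \<subseteq> {0}" using nonzero_Basis by blast
  then obtain u c where u: "u \<noteq> 0" "f u = c *\<^sub>R u" and ge: "\<And>x. c * (x \<bullet> x) \<le> x \<bullet> f x"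
    using invariant_subspace_min_eigenvector[OF assms subspace_UNIV subset_UNIV] by (metis UNIV_I)
  have "c \<le> d" if "d \<in> eigenvalues f" for d
  proof -
    obtain v where "v \<noteq> 0" "f v = d *\<^sub>R v" using \<open>d \<in> eigenvalues f\<close> by (auto simp: eigenvalues_def)
    thus ?thesis using ge[of v] by simp
  qed
  moreover have "c \<in> eigenvalues f" using u by (auto simp: eigenvalues_def)
  ultimately have "lambda_min f = c"
    unfolding lambda_min_def by (intro Min_eqI finite_eigenvalues assms)
  thus ?thesis using that u ge by blast
qed

lemma lambda_min_le_form:
  fixes f :: "'a::euclidean_space \<Rightarrow> 'a"
  assumes "self_adjoint f"
  shows "lambda_min f * (x \<bullet> x) \<le> x \<bullet> f x"
  using lambda_min_eigenvector[OF assms] by metis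

lemma lambda_min_nonpos_if_form_nonpos:
  fixes f :: "'a::euclidean_space \<Rightarrow> 'a"
  assumes "self_adjoint f" "x \<noteq> 0" "x \<bullet> f x \<le> 0"
  shows "lambda_min f \<le> 0"
proof -
  have "lambda_min f * (x \<bullet> x) \<le> 0" using lambda_min_le_form[OF assms(1)] assms(3) by (rule order_trans)
  moreover have "0 < x \<bullet> x" using assms(2) by simp
  ultimately show ?thesis by (simp add: mult_le_0_iff)
qed

lemma eigenspace_uminus: "eigenspace (\<lambda>x. - f x) c = eigenspace f (- c)"
  by (auto simp: eigenspace_def) (metis minus_minus)

lemma eigenvalues_iff_eigenspace: "c \<in> eigenvalues f \<longleftrightarrow> \<not> eigenspace f c \<subseteq> {0}"
  by (auto simp: eigenvalues_def eigenspace_def)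

text \<open>The negated smallest eigenvalue of \<open>- f\<close> is an eigenvalue of
  \<open>f\<close>, hence at most \<open>lambda_max f\<close>.\<close>

lemma form_le_lambda_max:
  fixes f :: "'a::euclidean_space \<Rightarrow> 'a"
  assumes "self_adjoint f"
  shows "x \<bullet> f x \<le> lambda_max f * (x \<bullet> x)"
proof -
  have sa: "self_adjoint (\<lambda>x. - f x)" using assms by (rule self_adjoint_uminus)
  obtain u where u: "u \<noteq> 0" "- f u = lambda_min (\<lambda>x. - f x) *\<^sub>R u"
    using lambda_min_eigenvector[OF sa] by metis
  hence "f u = - lambda_min (\<lambda>x. - f x) *\<^sub>R u" by (metis minus_minus scaleR_minus_left)
  hence "- lambda_min (\<lambda>x. - f x) \<in> eigenvalues f" using u(1) by (auto simp: eigenvalues_def)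
  hence "- lambda_min (\<lambda>x. - f x) \<le> lambda_max f"
    unfolding lambda_max_def by (intro Max_ge finite_eigenvalues assms)
  hence "- lambda_min (\<lambda>x. - f x) * (x \<bullet> x) \<le> lambda_max f * (x \<bullet> x)"
    by (intro mult_right_mono) auto
  thus ?thesis using lambda_min_le_form[OF sa, of x] by simp
qed

subsection \<open>Sums of eigenspaces and inertia\<close>

text \<open>Arbitrary \<open>C\<close> treats the positive, negative and null spaces uniformly
  through half-lines and \<open>{0}\<close>; a non-eigenvalue in \<open>C\<close> contributes only
  the zero vector.\<close>

definition eigensum :: "('a::real_vector \<Rightarrow> 'a) \<Rightarrow> real set \<Rightarrow> 'a set"
  where "eigensum f C = span (\<Union>c\<in>C. eigenspace f c)"

lemma subspace_eigensum: "subspace (eigensum f C)"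
  by (simp add: eigensum_def)

lemma eigensum_invariant:
  assumes "linear f"
  shows "f ` eigensum f C \<subseteq> eigensum f C"
proof -
  have "f ` (\<Union>c\<in>C. eigenspace f c) \<subseteq> eigensum f C"
  proof clarify
    fix c x assume "c \<in> C" "x \<in> eigenspace f c"
    moreover from this have "x \<in> eigensum f C" unfolding eigensum_def by (blast intro: span_base)
    ultimately show "f x \<in> eigensum f C"
      by (simp add: eigenspace_def subspace_scale subspace_eigensum)
  qed
  thus ?thesis
    using linear_span_image[OF assms, of "\<Union>c\<in>C. eigenspace f c"]
    by (metis eigensum_def span_minimal subspace_eigensum)
qed

lemma eigensum_orthogonal:
  assumes "self_adjoint f" "C \<inter> D = {}" "x \<in> eigensum f C" "y \<in> eigensum f D"
  shows "orthogonal x y"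
proof -
  have 1: "orthogonal z y" if z: "z \<in> eigenspace f c" "c \<in> C" for z c
  proof (rule orthogonal_to_span[OF assms(4)[unfolded eigensum_def]])
    fix w assume "w \<in> (\<Union>d\<in>D. eigenspace f d)"
    then obtain d where "d \<in> D" "w \<in> eigenspace f d" by blast
    thus "orthogonal z w" using eigenspaces_orthogonal[OF assms(1) z(1)] z(2) assms(2) by blast
  qed
  have "orthogonal y x"
    using assms(3) unfolding eigensum_def
    by (rule orthogonal_to_span) (use 1 in \<open>auto simp: orthogonal_commute\<close>)
  thus ?thesis by (simp add: orthogonal_commute)
qed

lemma dim_eigensum_Un:
  fixes f :: "'a::euclidean_space \<Rightarrow> 'a"
  assumes "self_adjoint f" "C \<inter> D = {}"
  shows "dim (eigensum f (C \<union> D)) = dim (eigensum f C) + dim (eigensum f D)"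
proof -
  have "dim (eigensum f C \<union> eigensum f D) = dim (eigensum f C) + dim (eigensum f D)"
    using eigensum_orthogonal[OF assms] by (intro dim_orthogonal_sum) (auto simp: orthogonal_def)
  moreover have "eigensum f (C \<union> D) = span (eigensum f C \<union> eigensum f D)"
    by (simp add: eigensum_def span_Un UN_Un span_span)
  ultimately show ?thesis by simp
qed

text \<open>Orthogonality makes dimensions additive over finite sets, and \<open>C\<close> may be
  cut down to the finitely many eigenvalues it contains. The right-hand side is the shape of the
  entries of \<open>inertia\<close>.\<close>

lemma dim_eigensum:
  fixes f :: "'a::euclidean_space \<Rightarrow> 'a"
  assumes f: "self_adjoint f"
  shows "dim (eigensum f C) = (\<Sum>c \<in> {c \<in> eigenvalues f. c \<in> C}. eigenvalue_multiplicity f c)"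
proof -
  have *: "dim (eigensum f D) = (\<Sum>c\<in>D. eigenvalue_multiplicity f c)" if "finite D" for D
    using that
  proof (induction D)
    case empty
    show ?case by (simp add: eigensum_def)
  next
    case (insert c D)
    have "dim (eigensum f (insert c D)) = dim (eigensum f {c}) + dim (eigensum f D)"
      using dim_eigensum_Un[OF f, of "{c}" D] insert by simp
    thus ?case using insert by (simp add: eigensum_def eigenvalue_multiplicity_def)
  qed
  have "eigenspace f c \<subseteq> {0}" if "c \<notin> eigenvalues f" for c
    using that by (simp add: eigenvalues_iff_eigenspace)
  hence "(\<Union>c\<in>C. eigenspace f c) \<subseteq> insert 0 (\<Union>c\<in>{c \<in> eigenvalues f. c \<in> C}. eigenspace f c)"
    by blast
  hence "eigensum f C \<subseteq> eigensum f {c \<in> eigenvalues f. c \<in> C}"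
    unfolding eigensum_def by (metis span_insert_0 span_mono)
  moreover have "eigensum f {c \<in> eigenvalues f. c \<in> C} \<subseteq> eigensum f C"
    unfolding eigensum_def by (intro span_mono) blast
  ultimately have "eigensum f C = eigensum f {c \<in> eigenvalues f. c \<in> C}" by blast
  thus ?thesis using *[of "{c \<in> eigenvalues f. c \<in> C}"] finite_eigenvalues[OF f] by simp
qed

lemma inertia_eq_dim:
  fixes f :: "'a::euclidean_space \<Rightarrow> 'a"
  assumes "self_adjoint f"
  shows "inertia f = (dim (eigensum f {0<..}), dim (eigensum f {..<0}), dim (eigensum f {0}))"
  by (simp add: inertia_def dim_eigensum[OF assms])

text \<open>This is the spectral theorem: the orthogonal complement of all eigenspaces is invariant,
  so if nonzero it would contain an eigenvector, which would be orthogonal to itself.\<close>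

lemma eigensum_UNIV:
  fixes f :: "'a::euclidean_space \<Rightarrow> 'a"
  assumes f: "self_adjoint f"
  shows "eigensum f UNIV = UNIV"
proof -
  define V where "V = (eigensum f UNIV)\<^sup>\<bottom>"
  have lin: "linear f" and sa: "\<And>x y. x \<bullet> f y = f x \<bullet> y"
    using f by (auto simp: self_adjoint_def)
  have "f ` V \<subseteq> V"
    using eigensum_invariant[OF lin, of UNIV]
    by (force simp: V_def orthogonal_comp_def orthogonal_def sa)
  have "V \<subseteq> {0}"
  proof (rule ccontr)
    assume "\<not> V \<subseteq> {0}"
    then obtain c u where u: "u \<in> V" "u \<noteq> 0" "f u = c *\<^sub>R u"
      using invariant_subspace_min_eigenvector[OF f _ \<open>f ` V \<subseteq> V\<close>]
      by (metis V_def subspace_orthogonal_comp)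
    have "u \<in> eigensum f UNIV"
      unfolding eigensum_def by (rule span_base) (use u in \<open>auto simp: eigenspace_def\<close>)
    hence "orthogonal u u" using u by (simp add: V_def orthogonal_comp_def)
    thus False using u by (simp add: orthogonal_self)
  qed
  hence "(eigensum f UNIV)\<^sup>\<bottom> = {0}"
    using subspace_0[OF subspace_orthogonal_comp] unfolding V_def by blast
  thus ?thesis
    using orthogonal_comp_self[OF subspace_eigensum, of f UNIV] by simp
qed

lemma dim_eigensum_Compl:
  fixes f :: "'a::euclidean_space \<Rightarrow> 'a"
  assumes "self_adjoint f"
  shows "dim (eigensum f C) + dim (eigensum f (- C)) = DIM('a)"
  using dim_eigensum_Un[OF assms, of C "- C"] by (simp add: eigensum_UNIV[OF assms])

text \<open>A minimal eigenvector inside the sum with eigenvalue outside \<open>C\<close> would be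
  orthogonal to itself. Thus the signs of the numbers in \<open>C\<close> control the sign of the
  form.\<close>

lemma eigensum_min_eigenvector:
  fixes f :: "'a::euclidean_space \<Rightarrow> 'a"
  assumes f: "self_adjoint f" and nz: "\<not> eigensum f C \<subseteq> {0}"
  obtains c where "c \<in> C" "\<And>x. x \<in> eigensum f C \<Longrightarrow> c * (x \<bullet> x) \<le> x \<bullet> f x"
proof -
  have "f ` eigensum f C \<subseteq> eigensum f C"
    using f by (simp add: self_adjoint_def eigensum_invariant)
  then obtain u c where u: "u \<in> eigensum f C" "u \<noteq> 0" "f u = c *\<^sub>R u"
    and ge: "\<And>x. x \<in> eigensum f C \<Longrightarrow> c * (x \<bullet> x) \<le> x \<bullet> f x"
    using invariant_subspace_min_eigenvector[OF f subspace_eigensum _ nz] by metis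
  have "c \<in> C"
  proof (rule ccontr)
    assume "c \<notin> C"
    have "u \<in> eigensum f {c}"
      unfolding eigensum_def by (rule span_base) (use u in \<open>auto simp: eigenspace_def\<close>)
    hence "orthogonal u u" using eigensum_orthogonal[OF f _ u(1), of "{c}"] \<open>c \<notin> C\<close> by blast
    thus False using u by (simp add: orthogonal_self)
  qed
  thus ?thesis using that ge by blast
qed

lemma eigensum_uminus: "eigensum (\<lambda>x. - f x) C = eigensum f (uminus ` C)"
  by (simp add: eigensum_def eigenspace_uminus)

section \<open>Sylvester's law of inertia\<close>

lemma form_pos_on_eigensum:
  fixes f :: "'a::euclidean_space \<Rightarrow> 'a"
  assumes "self_adjoint f" "x \<in> eigensum f {0<..}" "x \<noteq> 0"
  shows "0 < x \<bullet> f x"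
proof -
  have "\<not> eigensum f {0<..} \<subseteq> {0}" using assms by blast
  then obtain c where c: "0 < c" "c * (x \<bullet> x) \<le> x \<bullet> f x"
    using eigensum_min_eigenvector[OF assms(1)] assms(2) by (metis greaterThan_iff)
  have "0 < c * (x \<bullet> x)" using c assms(3) by simp
  thus ?thesis using c by linarith
qed

text \<open>Here \<open>- f\<close> has its eigenvalues in \<open>{0..}\<close>. The closed
  half-line is the complement of \<open>{0<..}\<close>, so the two dimensions add up to that of the
  whole space.\<close>

lemma form_nonpos_on_eigensum:
  fixes f :: "'a::euclidean_space \<Rightarrow> 'a"
  assumes "self_adjoint f" "x \<in> eigensum f {..0}"
  shows "x \<bullet> f x \<le> 0"
proof (cases "x = 0")
  case False
  have x: "x \<in> eigensum (\<lambda>x. - f x) {0..}" using assms by (simp add: eigensum_uminus)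
  hence "\<not> eigensum (\<lambda>x. - f x) {0..} \<subseteq> {0}" using False by blast
  then obtain c where c: "0 \<le> c" "c * (x \<bullet> x) \<le> x \<bullet> - f x"
    using eigensum_min_eigenvector[OF self_adjoint_uminus[OF assms(1)]] x by (metis atLeast_iff)
  have "0 \<le> c * (x \<bullet> x)" using c by simp
  thus ?thesis using c unfolding inner_minus_right by linarith
qed simp

text \<open>The form of \<open>f\<close> is positive on \<open>eigensum f {0<..}\<close>, so the image under \<open>T\<close> of this space meets
  \<open>eigensum g {..0}\<close>, where the form of \<open>g\<close> is nonpositive, only in \<open>0\<close>.\<close>

lemma dim_positive_eigensum_mono:
  fixes f :: "'a::euclidean_space \<Rightarrow> 'a" and g :: "'b::euclidean_space \<Rightarrow> 'b"
  assumes f: "self_adjoint f" and g: "self_adjoint g" and T: "linear T" "inj T"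
    and form: "\<And>x. T x \<bullet> g (T x) = x \<bullet> f x"
  shows "dim (eigensum f {0<..}) \<le> dim (eigensum g {0<..})"
proof -
  define P where "P = T ` eigensum f {0<..}"
  define N where "N = eigensum g {..0}"
  have P: "subspace P" and N: "subspace N"
    by (simp_all add: P_def N_def subspace_eigensum linear_subspace_image T)
  have "y = 0" if y: "y \<in> P \<inter> N" for y
  proof (rule ccontr)
    assume "y \<noteq> 0"
    obtain x where x: "x \<in> eigensum f {0<..}" "y = T x" using y by (auto simp: P_def)
    hence "x \<noteq> 0" using \<open>y \<noteq> 0\<close> by (auto simp: linear_0[OF T(1)])
    hence "0 < x \<bullet> f x" using form_pos_on_eigensum[OF f] x by blast
    also have "x \<bullet> f x = y \<bullet> g y" by (simp add: form x)
    also have "\<dots> \<le> 0" using form_nonpos_on_eigensum[OF g] y by (simp add: N_def)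
    finally show False by simp
  qed
  hence "P \<inter> N \<subseteq> {0}" by blast
  hence "dim (P \<inter> N) = 0" by simp
  \<comment> \<open>Subspaces with trivial intersection have dimensions summing to at most that of
    the space, while \<open>N\<close> has codimension
    \<open>dim (eigensum g {0<..})\<close>.\<close>
  hence "dim P + dim N \<le> DIM('b)"
    using dim_sums_Int[OF P N] dim_subset_UNIV[of "{x + y |x y. x \<in> P \<and> y \<in> N}"]
    by (simp del: dim_eq_0)
  moreover have "dim (eigensum g {0<..}) + dim N = DIM('b)"
    using dim_eigensum_Compl[OF g, of "{0<..}"] by (simp add: N_def)
  moreover have "dim P = dim (eigensum f {0<..})"
    unfolding P_def using T by (intro dim_image_eq) (auto intro: inj_on_subset)
  ultimately show ?thesis by simp
qed

lemma dim_negative_eigensum_mono: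
  fixes f :: "'a::euclidean_space \<Rightarrow> 'a" and g :: "'b::euclidean_space \<Rightarrow> 'b"
  assumes "self_adjoint f" "self_adjoint g" "linear T" "inj T"
    and "\<And>x. T x \<bullet> g (T x) = x \<bullet> f x"
  shows "dim (eigensum f {..<0}) \<le> dim (eigensum g {..<0})"
proof -
  have "T x \<bullet> - g (T x) = x \<bullet> - f x" for x using assms(5) by simp
  from dim_positive_eigensum_mono[OF assms(1,2)[THEN self_adjoint_uminus] assms(3,4) this]
  show ?thesis by (simp add: eigensum_uminus)
qed

text \<open>Monotonicity along \<open>T\<close> and along its inverse gives equality of the positive
  and of the negative counts; the null count is what remains of the dimension.\<close>

theorem sylvester_inertia:
  fixes f g T :: "'a::euclidean_space \<Rightarrow> 'a"
  assumes f: "self_adjoint f" and g: "self_adjoint g" and T: "linear T" "inj T"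
    and form: "\<And>x. T x \<bullet> g (T x) = x \<bullet> f x"
  shows "inertia g = inertia f"
proof -
  obtain T' where T': "linear T'" "\<And>x. T' (T x) = x" "\<And>x. T (T' x) = x"
    using linear_injective_isomorphism[OF T] by metis
  have "inj T'" by (metis T'(3) injI)
  have form': "T' x \<bullet> f (T' x) = x \<bullet> g x" for x
    using form[of "T' x"] T' by simp
  have "dim (eigensum g {0<..}) = dim (eigensum f {0<..})"
    by (intro antisym dim_positive_eigensum_mono[OF g f T'(1) \<open>inj T'\<close> form']
        dim_positive_eigensum_mono[OF f g T form])
  moreover have "dim (eigensum g {..<0}) = dim (eigensum f {..<0})"
    by (intro antisym dim_negative_eigensum_mono[OF g f T'(1) \<open>inj T'\<close> form']
        dim_negative_eigensum_mono[OF f g T form])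
  moreover have "dim (eigensum h {0<..}) + (dim (eigensum h {..<0}) + dim (eigensum h {0})) = DIM('a)"
    if "self_adjoint h" for h :: "'a \<Rightarrow> 'a"
  proof -
    have "{..<0::real} \<union> {0} = - {0<..}" by auto
    thus ?thesis
      using dim_eigensum_Compl[OF that, of "{0<..}"] dim_eigensum_Un[OF that, of "{..<0}" "{0}"]
      by simp
  qed
  from this[OF f] this[OF g] calculation show ?thesis
    by (simp add: inertia_eq_dim f g)
qed

section \<open>Multiplicities under conjugation\<close>

lemma eigenvalues_eq_multiplicity:
  "eigenvalues f = {c. eigenvalue_multiplicity f c \<noteq> 0}"
  by (auto simp: eigenvalues_iff_eigenspace eigenvalue_multiplicity_def)

lemma eigenvalue_multiplicity_conj:
  fixes f g T :: "'a::euclidean_space \<Rightarrow> 'a"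
  assumes T: "linear T" "bij T" and g: "\<And>x. g (T x) = T (f x)"
  shows "eigenvalue_multiplicity g = eigenvalue_multiplicity f"
proof
  fix c
  have "eigenspace g c = T ` eigenspace f c"
  proof (intro set_eqI iffI)
    fix y assume "y \<in> eigenspace g c"
    moreover obtain x where x: "y = T x" using T by (meson bij_pointE)
    ultimately have "T (f x) = T (c *\<^sub>R x)"
      by (simp add: eigenspace_def g linear_cmul[OF T(1)])
    hence "f x = c *\<^sub>R x" using T by (meson bij_is_inj injD)
    thus "y \<in> T ` eigenspace f c" using x by (simp add: eigenspace_def)
  qed (auto simp: eigenspace_def g linear_cmul[OF T(1)])
  thus "eigenvalue_multiplicity g c = eigenvalue_multiplicity f c"
    unfolding eigenvalue_multiplicity_def
    using T by (auto intro!: dim_image_eq intro: bij_is_inj inj_on_subset)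
qed

section \<open>Matrix norms\<close>

lemma
  fixes A :: "real ^ 'k ^ 'k"
  assumes "invertible A"
  shows matrix_inv_right: "A ** matrix_inv A = mat 1"
    and matrix_inv_left: "matrix_inv A ** A = mat 1"
  using assms someI_ex[of "\<lambda>B. A ** B = mat 1 \<and> B ** A = mat 1"]
  by (simp_all add: invertible_def matrix_inv_def)

lemma inner_transpose:
  fixes G H :: "real ^ 'b ^ 'a"
  shows "transpose G \<bullet> transpose H = G \<bullet> H"
  by (simp add: inner_vec_def transpose_def) (rule sum.swap)

lemma self_adjoint_gram:
  fixes A :: "real ^ 'b ^ 'a"
  shows "self_adjoint ((*v) (A ** transpose A))"
proof -
  have "x \<bullet> ((A ** transpose A) *v y) = ((A ** transpose A) *v x) \<bullet> y" for x y
    by (metis dot_lmul_matrix transpose_matrix_vector matrix_transpose_mul transpose_transpose)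
  thus ?thesis by (simp add: self_adjoint_def matrix_vector_mul_linear)
qed

text \<open>The squared Frobenius norm of \<open>G ** A\<close> splits over the rows of
  \<open>G\<close>, so eigenvalue bounds for the form of \<open>A ** transpose A\<close> on vectors
  carry over to matrices.\<close>

lemma inner_mult_right_eq_sum_rows:
  fixes G :: "real ^ 'k ^ 'm" and A :: "real ^ 'n ^ 'k"
  shows "(G ** A) \<bullet> (G ** A) = (\<Sum>i\<in>UNIV. G $ i \<bullet> ((A ** transpose A) *v G $ i))"
proof -
  define B where "B = A ** transpose A"
  have "transpose B = B" by (simp add: B_def matrix_transpose_mul)
  moreover have "(G ** B) $ i = transpose B *v G $ i" for i
    by (simp add: vec_eq_iff matrix_matrix_mult_def matrix_vector_mult_def transpose_def mult.commute
        del: transpose_matrix_vector)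
  moreover have "(G ** A) \<bullet> (G ** A) = G \<bullet> (G ** B)"
    by (simp add: inner_matrix_mult_right B_def matrix_mul_assoc)
  ultimately show ?thesis by (simp add: inner_vec_def[of G] B_def)
qed

lemma inner_mult_right_le_lambda_max:
  fixes G :: "real ^ 'k ^ 'm" and A :: "real ^ 'n ^ 'k"
  shows "(G ** A) \<bullet> (G ** A) \<le> lambda_max ((*v) (A ** transpose A)) * (G \<bullet> G)"
  unfolding inner_mult_right_eq_sum_rows inner_vec_def[of G G] sum_distrib_left
  by (intro sum_mono form_le_lambda_max self_adjoint_gram)

lemma inner_mult_right_ge_lambda_min:
  fixes G :: "real ^ 'k ^ 'm" and A :: "real ^ 'n ^ 'k"
  shows "lambda_min ((*v) (A ** transpose A)) * (G \<bullet> G) \<le> (G ** A) \<bullet> (G ** A)"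
  unfolding inner_mult_right_eq_sum_rows inner_vec_def[of G G] sum_distrib_left
  by (intro sum_mono lambda_min_le_form self_adjoint_gram)

text \<open>At a minimal eigenvector \<open>u\<close> the form equals the squared norm of
  \<open>u v* A\<close>, which is nonzero because \<open>A\<close> is invertible.\<close>

lemma lambda_min_gram_pos:
  fixes A :: "real ^ 'k ^ 'k"
  assumes "invertible A"
  shows "0 < lambda_min ((*v) (A ** transpose A))"
proof -
  obtain u where u: "u \<noteq> 0" "(A ** transpose A) *v u = lambda_min ((*v) (A ** transpose A)) *\<^sub>R u"
    using lambda_min_eigenvector[OF self_adjoint_gram] by metis
  have "u v* A \<noteq> 0"
  proof
    assume "u v* A = 0"
    hence "u v* (A ** matrix_inv A) = 0" by (simp flip: vector_matrix_mul_assoc)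
    thus False using u(1) by (simp add: matrix_inv_right[OF assms])
  qed
  moreover have "lambda_min ((*v) (A ** transpose A)) * (u \<bullet> u) = (u v* A) \<bullet> (u v* A)"
    using arg_cong[OF u(2), of "inner u"]
    by (simp add: dot_lmul_matrix flip: matrix_vector_mul_assoc)
  ultimately have "0 < lambda_min ((*v) (A ** transpose A)) * (u \<bullet> u)" by simp
  moreover have "0 < u \<bullet> u" using u(1) by simp
  ultimately show ?thesis using zero_less_mult_pos2 by blast
qed

text \<open>The lower bound for \<open>A ** transpose A\<close>, applied to \<open>Y\<close>, gives
  \<open>c * (Y \<bullet> Y) \<le> b\<close>; Cauchy-Schwarz on \<open>b = H \<bullet> Y\<close>
  then bounds \<open>b\<close> without the spectrum of the inverse.\<close>

lemma inner_inv_mult_left_le: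
  fixes H :: "real ^ 'n ^ 'k" and A :: "real ^ 'k ^ 'k"
  assumes A: "invertible A"
  shows "(matrix_inv A ** H) \<bullet> (matrix_inv A ** H) \<le>
    1 / lambda_min ((*v) (A ** transpose A)) * (H \<bullet> H)"
proof -
  define B where "B = matrix_inv A"
  define c where "c = lambda_min ((*v) (A ** transpose A))"
  \<comment> \<open>\<open>Y = (A A^T)^{-1} H\<close>, so that \<open>A^T Y = B H\<close>.\<close>
  define Y where "Y = transpose B ** B ** H"
  define b where "b = (B ** H) \<bullet> (B ** H)"
  have c: "0 < c" unfolding c_def using A by (rule lambda_min_gram_pos)
  have b: "b = H \<bullet> Y"
    by (simp add: b_def Y_def inner_matrix_mult_left matrix_mul_assoc)
  have "transpose Y ** A = transpose (B ** H) ** (B ** A)"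
    by (simp add: Y_def matrix_transpose_mul matrix_mul_assoc)
  also have "\<dots> = transpose (B ** H)" by (simp add: B_def matrix_inv_left[OF A])
  finally have "c * (Y \<bullet> Y) \<le> b"
    using inner_mult_right_ge_lambda_min[of A "transpose Y"]
    by (simp add: inner_transpose b_def c_def)
  moreover have "b\<^sup>2 \<le> (H \<bullet> H) * (Y \<bullet> Y)" unfolding b by (rule Cauchy_Schwarz_ineq)
  ultimately have "c * b\<^sup>2 \<le> (H \<bullet> H) * b"
    using c by (smt (verit) inner_ge_zero mult.left_commute mult_left_mono)
  hence "(c * b) * b \<le> (H \<bullet> H) * b" by (simp add: power2_eq_square mult.assoc)
  moreover have "0 \<le> b" by (simp add: b_def)
  ultimately have "c * b \<le> H \<bullet> H"
    by (cases "b = 0") (auto simp: mult_le_cancel_right_pos)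
  thus ?thesis using c by (simp add: field_simps b_def c_def B_def)
qed

section \<open>The Hessian along an orbit\<close>

lemma linear_L: "linear (L A)"
  by (intro linearI)
    (simp_all add: L_def vec_eq_iff matrix_matrix_mult_def sum.distrib sum_distrib_left algebra_simps)

text \<open>\<open>A\<close> and \<open>matrix_inv A\<close> meet in the middle and cancel. Two
  points \<open>p\<close> and \<open>q\<close> are allowed because the Hessian form mixes the base
  point with directions.\<close>

lemma mult_L_L:
  assumes "invertible A"
  shows "fst (L A p) ** snd (L A q) = fst p ** snd q"
proof -
  have "fst (L A p) ** snd (L A q) = fst p ** (A ** matrix_inv A) ** snd q"
    by (simp add: L_def matrix_mul_assoc)
  thus ?thesis by (simp add: matrix_inv_right[OF assms])
qed

lemma inj_L:
  assumes "invertible A"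
  shows "inj (L A)"
proof (rule injI)
  fix p q assume eq: "L A p = L A q"
  have "fst p ** (A ** matrix_inv A) = fst q ** (A ** matrix_inv A)"
    using eq by (simp add: L_def matrix_mul_assoc)
  moreover have "(A ** matrix_inv A) ** snd p = (A ** matrix_inv A) ** snd q"
    using eq by (simp add: L_def flip: matrix_mul_assoc)
  ultimately show "p = q" by (simp add: matrix_inv_right[OF assms] prod_eq_iff)
qed

lemma J_L: "invertible A \<Longrightarrow> J X (L A p) = J X p"
  by (simp add: J_def mult_L_L)

text \<open>The residual \<open>E\<close> is unchanged, and each gradient component is only
  multiplied by a matrix, so zero stays zero.\<close>

lemma critical_point_L:
  assumes A: "invertible A" and p: "critical_point (J X) p"
  shows "critical_point (J X) (L A p)"
proof -
  define E where "E = fst p ** snd p - X"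
  have "E ** transpose (snd p) = 0" "transpose (fst p) ** E = 0"
    using p grad_J[of X "fst p" "snd p"] by (simp_all add: critical_point_def E_def prod_eq_iff)
  moreover have "grad (J X) (L A p) =
    (E ** transpose (snd p) ** transpose (matrix_inv A), transpose A ** (transpose (fst p) ** E))"
    using grad_J[of X "fst (L A p)" "snd (L A p)"]
    by (simp add: mult_L_L[OF A] E_def) (simp add: L_def matrix_transpose_mul matrix_mul_assoc)
  ultimately show ?thesis by (simp add: critical_point_def zero_prod_def)
qed

text \<open>Moving the transposed factors across the inner product pairs the first-order changes of
  the matrix product along \<open>u\<close> and \<open>v\<close>, and pairs the residual with its
  mixed second-order change. The result is visibly symmetric in \<open>u\<close> and
  \<open>v\<close>.\<close>

lemma inner_hess_J:
  fixes X :: "real ^ 'n ^ 'm" and p u v :: "(real ^ 'k ^ 'm) \<times> (real ^ 'n ^ 'k)"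
  shows "u \<bullet> hess (J X) p v =
    (fst u ** snd p + fst p ** snd u) \<bullet> (fst v ** snd p + fst p ** snd v) +
    (fst p ** snd p - X) \<bullet> (fst u ** snd v + fst v ** snd u)"
proof -
  obtain W S G H G' H' where p: "p = (W, S)" "u = (G, H)" "v = (G', H')" by (metis surj_pair)
  define E where "E = W ** S - X"
  have *: "transpose W ** W ** H' + transpose W ** G' ** S = transpose W ** (W ** H' + G' ** S)"
    by (simp add: matrix_add_ldistrib matrix_mul_assoc)
  show ?thesis
    unfolding p hess_J E_def[symmetric] * fst_conv snd_conv inner_Pair inner_add_right
      inner_matrix_mult_right[symmetric] inner_matrix_mult_left[symmetric]
    by (simp add: inner_add_left inner_add_right inner_commute[of E])
qed

lemma self_adjoint_hess_J:
  fixes X :: "real ^ 'n ^ 'm" and p :: "(real ^ 'k ^ 'm) \<times> (real ^ 'n ^ 'k)"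
  shows "self_adjoint (hess (J X) p)"
proof -
  have "grad (J X) differentiable at p"
    using has_derivative_grad_J[where X = X and W = "fst p" and S = "snd p"]
    unfolding differentiable_def prod.collapse by blast
  hence "linear (hess (J X) p)" unfolding hess_def by (rule linear_frechet_derivative)
  moreover have "u \<bullet> hess (J X) p v = hess (J X) p u \<bullet> v" for u v
  proof -
    have "u \<bullet> hess (J X) p v = v \<bullet> hess (J X) p u"
      by (simp only: inner_hess_J inner_commute[of "fst v ** snd p + fst p ** snd v"]
          add.commute[of "fst v ** snd u"])
    thus ?thesis by (simp only: inner_commute[of v])
  qed
  ultimately show ?thesis by (simp add: self_adjoint_def)
qed

lemma inner_hess_J_L:
  assumes "invertible A"
  shows "L A u \<bullet> hess (J X) (L A p) (L A v) = u \<bullet> hess (J X) p v"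
  by (simp add: inner_hess_J mult_L_L[OF assms])

lemma inertia_hess_J_L:
  assumes "invertible A"
  shows "inertia (hess (J X) (L A p)) = inertia (hess (J X) p)"
  by (rule sylvester_inertia[OF self_adjoint_hess_J self_adjoint_hess_J linear_L inj_L[OF assms]])
    (rule inner_hess_J_L[OF assms])

section \<open>Orthogonal orbits\<close>

lemma orthogonal_matrix_invertible:
  "orthogonal_matrix Q \<Longrightarrow> invertible Q"
  by (auto simp: orthogonal_matrix_def invertible_def)

lemma inner_L_orthogonal:
  assumes Q: "orthogonal_matrix Q"
  shows "L Q u \<bullet> L Q v = u \<bullet> v"
proof -
  have QQ: "transpose Q ** Q = mat 1" "Q ** transpose Q = mat 1"
    using Q by (simp_all add: orthogonal_matrix_def)
  have "matrix_inv Q = matrix_inv Q ** (Q ** transpose Q)" by (simp add: QQ)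
  also have "\<dots> = transpose Q"
    by (simp add: matrix_mul_assoc matrix_inv_left[OF orthogonal_matrix_invertible[OF Q]])
  finally have inv: "matrix_inv Q = transpose Q" .
  have "(fst u ** Q) \<bullet> (fst v ** Q) = fst u \<bullet> (fst v ** (Q ** transpose Q))"
    by (simp add: inner_matrix_mult_right matrix_mul_assoc)
  moreover have "(transpose Q ** snd u) \<bullet> (transpose Q ** snd v) =
      snd u \<bullet> ((Q ** transpose Q) ** snd v)"
    by (simp add: inner_matrix_mult_left matrix_mul_assoc)
  ultimately show ?thesis by (simp add: L_def inv QQ inner_prod_def)
qed

text \<open>A congruence by an isometry is a conjugation: both sides have equal inner products with
  every \<open>L Q u\<close>, and these exhaust the space.\<close>

lemma hess_J_L_orthogonal:
  assumes Q: "orthogonal_matrix Q"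
  shows "hess (J X) (L Q p) (L Q v) = L Q (hess (J X) p v)"
proof -
  have inv: "invertible Q" using Q by (rule orthogonal_matrix_invertible)
  have surj: "surj (L Q)" by (rule linear_inj_imp_surj[OF linear_L inj_L[OF inv]])
  have "w \<bullet> hess (J X) (L Q p) (L Q v) = w \<bullet> L Q (hess (J X) p v)" for w
  proof -
    obtain u where "w = L Q u" using surj by (rule surjE)
    thus ?thesis by (simp only: inner_hess_J_L[OF inv] inner_L_orthogonal[OF Q])
  qed
  thus ?thesis using vector_eq_ldot by blast
qed

lemma eigenvalue_multiplicity_hess_J_L:
  fixes X :: "real ^ 'n ^ 'm" and p :: "(real ^ 'k ^ 'm) \<times> (real ^ 'n ^ 'k)"
  assumes Q: "orthogonal_matrix Q"
  shows "eigenvalue_multiplicity (hess (J X) (L Q p)) = eigenvalue_multiplicity (hess (J X) p)"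
proof (rule eigenvalue_multiplicity_conj[OF linear_L])
  show "bij (L Q)"
    using Q by (intro bijI linear_inj_imp_surj linear_L inj_L orthogonal_matrix_invertible)
qed (rule hess_J_L_orthogonal[OF Q])

section \<open>The bound on the smallest eigenvalue\<close>

lemma inner_L_le:
  fixes v :: "(real ^ 'k ^ 'm) \<times> (real ^ 'n ^ 'k)"
  assumes A: "invertible A"
  shows "L A v \<bullet> L A v \<le>
    max (lambda_max ((*v) (A ** transpose A))) (1 / lambda_min ((*v) (A ** transpose A))) * (v \<bullet> v)"
    (is "_ \<le> max ?a ?b * _")
proof -
  have "(fst v ** A) \<bullet> (fst v ** A) \<le> max ?a ?b * (fst v \<bullet> fst v)"
    by (rule order_trans[OF inner_mult_right_le_lambda_max]) (simp add: mult_right_mono)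
  moreover have "(matrix_inv A ** snd v) \<bullet> (matrix_inv A ** snd v) \<le> max ?a ?b * (snd v \<bullet> snd v)"
    by (rule order_trans[OF inner_inv_mult_left_le[OF A]], rule mult_right_mono) simp_all
  ultimately show ?thesis by (simp add: L_def inner_prod_def distrib_left)
qed

text \<open>The sign hypothesis turns the upper bound on the norm of \<open>L A u\<close> into an
  upper bound on the Rayleigh quotient there.\<close>

lemma lambda_min_hess_J_L_le:
  fixes X :: "real ^ 'n ^ 'm" and p :: "(real ^ 'k ^ 'm) \<times> (real ^ 'n ^ 'k)"
  assumes A: "invertible A" and nonpos: "lambda_min (hess (J X) p) \<le> 0"
  shows "lambda_min (hess (J X) (L A p)) \<le> lambda_min (hess (J X) p) /
    max (lambda_max ((*v) (A ** transpose A))) (1 / lambda_min ((*v) (A ** transpose A)))"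
proof -
  define M where "M = max (lambda_max ((*v) (A ** transpose A))) (1 / lambda_min ((*v) (A ** transpose A)))"
  define c where "c = lambda_min (hess (J X) p)"
  define d where "d = lambda_min (hess (J X) (L A p))"
  have M: "0 < M" using lambda_min_gram_pos[OF A] by (simp add: M_def less_max_iff_disj)
  obtain u where u: "u \<noteq> 0" "hess (J X) p u = c *\<^sub>R u"
    using lambda_min_eigenvector[OF self_adjoint_hess_J] unfolding c_def by metis
  have "L A u \<noteq> 0"
    using u(1) inj_L[OF A] linear_0[OF linear_L] by (metis injD)
  hence pos: "0 < L A u \<bullet> L A u" by simp
  have "d * (L A u \<bullet> L A u) \<le> L A u \<bullet> hess (J X) (L A p) (L A u)"
    unfolding d_def by (rule lambda_min_le_form[OF self_adjoint_hess_J])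
  also have "\<dots> = c * (u \<bullet> u)" by (simp add: inner_hess_J_L[OF A] u)
  finally have "M * d * (L A u \<bullet> L A u) \<le> c * (M * (u \<bullet> u))"
    using M by (simp add: mult_left_mono mult.assoc mult.left_commute[of c])
  \<comment> \<open>Multiplying \<open>inner_L_le\<close> by \<open>c \<le> 0\<close> reverses
    it.\<close>
  also have "\<dots> \<le> c * (L A u \<bullet> L A u)"
    using inner_L_le[OF A, of u] nonpos by (intro mult_left_mono_neg) (simp_all add: M_def c_def)
  finally have "M * d \<le> c" using pos by simp
  hence "d \<le> c / M" using M by (simp add: field_simps)
  thus ?thesis by (simp add: c_def d_def M_def)
qed

text \<open>\<open>(W, -S)\<close> is the tangent at \<open>t = 0\<close> of the curve \<open>L ((1 + t) I) (W, S)\<close>, along which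
  \<open>J\<close> is constant; at a critical point the form of the Hessian vanishes on it.\<close>

lemma lambda_min_nonpos_if_critical:
  fixes X :: "real ^ 'n ^ 'm" and p :: "(real ^ 'k ^ 'm) \<times> (real ^ 'n ^ 'k)"
  assumes "critical_point (J X) p"
  shows "lambda_min (hess (J X) p) \<le> 0"
proof (cases "p = 0")
  case False
  obtain W S where p: "p = (W, S)" by force
  define E where "E = W ** S - X"
  have "E ** transpose S = 0"
    using assms by (simp add: p critical_point_def grad_J E_def zero_prod_def)
  hence "E \<bullet> (W ** S) = 0"
    by (simp add: inner_commute[of E] inner_matrix_mult_right)
  moreover have "W ** - S = - (W ** S)"
    by (simp add: vec_eq_iff matrix_matrix_mult_def sum_negf)
  ultimately have neg: "W ** S + W ** - S = 0" "E \<bullet> (W ** - S) = 0" by simp_all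
  \<comment> \<open>The first-order changes cancel, and criticality makes the residual orthogonal to
    \<open>W ** S\<close>.\<close>
  have "(W, - S) \<bullet> hess (J X) p (W, - S) =
      (W ** S + W ** - S) \<bullet> (W ** S + W ** - S) + E \<bullet> (W ** - S + W ** - S)"
    by (simp only: inner_hess_J p fst_conv snd_conv E_def)
  hence "(W, - S) \<bullet> hess (J X) p (W, - S) = 0"
    by (simp only: neg inner_add_right inner_zero_left)
  moreover have "(W, - S) \<noteq> 0" using False by (simp add: p zero_prod_def)
  ultimately show ?thesis
    using lambda_min_nonpos_if_form_nonpos[OF self_adjoint_hess_J] by (metis order_refl)
next
  case True
  \<comment> \<open>At the origin the tangent direction is zero. There the form at
    \<open>(G, H)\<close> is \<open>- 2 * (X \<bullet> (G ** H))\<close>, odd in \<open>H\<close>,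
    so one sign makes it nonpositive; all-ones matrices serve as nonzero \<open>G\<close> and
    \<open>H\<close>.\<close>
  define q where "q s = (1 :: real ^ 'k ^ 'm, s *\<^sub>R (1 :: real ^ 'n ^ 'k))" for s :: real
  define M where "M = (1 :: real ^ 'k ^ 'm) ** (1 :: real ^ 'n ^ 'k)"
  have M: "(1 :: real ^ 'k ^ 'm) ** s *\<^sub>R (1 :: real ^ 'n ^ 'k) = s *\<^sub>R M" for s
    unfolding M_def by (rule bounded_bilinear.scaleR_right[OF bounded_bilinear_matrix_mult])
  have "q s \<bullet> hess (J X) p (q s) = s * (- 2 * (X \<bullet> M))" for s
    by (simp add: q_def inner_hess_J True M flip: scaleR_2)
  hence "q 1 \<bullet> hess (J X) p (q 1) \<le> 0 \<or> q (-1) \<bullet> hess (J X) p (q (-1)) \<le> 0" by auto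
  moreover have "q s \<noteq> 0" for s by (simp add: q_def zero_prod_def)
  ultimately show ?thesis
    using lambda_min_nonpos_if_form_nonpos[OF self_adjoint_hess_J] by metis
qed

text \<open>The bound divides a negative number by a positive maximum, so negativity survives along
  the orbit.\<close>

lemma strict_saddle_L:
  assumes A: "invertible A" and p: "strict_saddle (J X) p"
  shows "strict_saddle (J X) (L A p)"
proof -
  have neg: "lambda_min (hess (J X) p) < 0" using p by (simp add: strict_saddle_def)
  have "0 < max (lambda_max ((*v) (A ** transpose A))) (1 / lambda_min ((*v) (A ** transpose A)))"
    using lambda_min_gram_pos[OF A] by (simp add: less_max_iff_disj)
  from divide_neg_pos[OF neg this] have "lambda_min (hess (J X) (L A p)) < 0"
    using lambda_min_hess_J_L_le[OF A] neg by (meson less_imp_le order_le_less_trans)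
  moreover have "critical_point (J X) (L A p)"
    using critical_point_L[OF A] p unfolding strict_saddle_def by blast
  ultimately show ?thesis by (simp add: strict_saddle_def)
qed

text \<open>The last conjunct assumes a critical point or a nonpositive \<open>lambda_min\<close>,
  the first implying the second; \<open>lambda_min_bound_fails\<close> refutes the bound at a point
  where \<open>lambda_min\<close> is 1. On orthogonal orbits the eigenvalues agree with
  multiplicity.\<close>

theorem theorem2p1:
  fixes X :: "real ^ 'n ^ 'm" and W :: "real ^ 'k ^ 'm" and S :: "real ^ 'n ^ 'k"
  shows
    "(critical_point (J X) (W, S) \<longrightarrow> (\<forall>q \<in> GL_orbit (W, S). critical_point (J X) q)) \<and>
     (global_minimum (J X) (W, S) \<longrightarrow> (\<forall>q \<in> GL_orbit (W, S). global_minimum (J X) q)) \<and>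
     (strict_saddle (J X) (W, S) \<longrightarrow> (\<forall>q \<in> GL_orbit (W, S). strict_saddle (J X) q)) \<and>
     (\<forall>q \<in> GL_orbit (W, S). inertia (hess (J X) q) = inertia (hess (J X) (W, S))) \<and>
     (\<forall>q \<in> O_orbit (W, S).
        eigenvalues (hess (J X) q) = eigenvalues (hess (J X) (W, S)) \<and>
        eigenvalue_multiplicity (hess (J X) q) = eigenvalue_multiplicity (hess (J X) (W, S))) \<and>
     (critical_point (J X) (W, S) \<or> lambda_min (hess (J X) (W, S)) \<le> 0 \<longrightarrow>
       (\<forall>A :: real ^ 'k ^ 'k. invertible A \<longrightarrow>
          lambda_min (hess (J X) (L A (W, S))) \<le>
            lambda_min (hess (J X) (W, S)) /
            max (lambda_max ((*v) (A ** transpose A)))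
                (1 / lambda_min ((*v) (A ** transpose A)))))"
proof (intro conjI impI ballI allI)
  fix q assume "critical_point (J X) (W, S)" and "q \<in> GL_orbit (W, S)"
  thus "critical_point (J X) q" by (auto simp: GL_orbit_def critical_point_L)
next
  fix q assume "global_minimum (J X) (W, S)" and "q \<in> GL_orbit (W, S)"
  thus "global_minimum (J X) q" by (auto simp: GL_orbit_def global_minimum_def J_L)
next
  fix q assume "strict_saddle (J X) (W, S)" and "q \<in> GL_orbit (W, S)"
  thus "strict_saddle (J X) q" by (auto simp: GL_orbit_def strict_saddle_L)
next
  fix q assume "q \<in> GL_orbit (W, S)"
  thus "inertia (hess (J X) q) = inertia (hess (J X) (W, S))"
    by (auto simp: GL_orbit_def inertia_hess_J_L)
next
  fix q assume "q \<in> O_orbit (W, S)"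
  thus "eigenvalue_multiplicity (hess (J X) q) = eigenvalue_multiplicity (hess (J X) (W, S))"
    by (auto simp: O_orbit_def eigenvalue_multiplicity_hess_J_L)
  thus "eigenvalues (hess (J X) q) = eigenvalues (hess (J X) (W, S))"
    by (simp add: eigenvalues_eq_multiplicity)
next
  fix A :: "real ^ 'k ^ 'k"
  assume "critical_point (J X) (W, S) \<or> lambda_min (hess (J X) (W, S)) \<le> 0" "invertible A"
  thus "lambda_min (hess (J X) (L A (W, S))) \<le> lambda_min (hess (J X) (W, S)) /
      max (lambda_max ((*v) (A ** transpose A))) (1 / lambda_min ((*v) (A ** transpose A)))"
    using lambda_min_hess_J_L_le lambda_min_nonpos_if_critical by blast
qed

end
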